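(* Let $e_1>e_2>e_3$ be real numbers, let $Q(s)=(s-e_1)(s-e_2)(s-e_3)$, and define $$\rho_Q(s)=\frac1{2\pi}\int_{e_2}^{e_1}\frac{dx}{\sqrt{(e_1-x)(x-e_2)(x-e_3)(x-s)}}\quad\text{for } e_3<s<e_2,$$ $$\rho_Q(s)=\frac1{2\pi}\int_{e_3}^{e_2}\frac{dx}{\sqrt{(e_1-x)(e_2-x)(x-e_3)(s-x)}}\quad\text{for } e_2<s<e_1.$$ Then $\rho_Q$ satisfies, on $(e_3,e_2)$ and on $(e_2,e_1)$, the Heun differential equation $$8Q(s)\rho_Q''(s)+8Q'(s)\rho_Q'(s)+Q''(s)\rho_Q(s)=0.$$ Both indices of this equation at each of the finite regular singularities $e_1,e_2,e_3$ vanish, while its indices at $\infty$ equal $\frac12$ and $\frac32$.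
   Context: For a second order linear equation $\rho''(s)+a_1(s)\rho'(s)+a_2(s)\rho(s)=0$, the indices at a finite regular singular point $\tilde s$ are the roots $\zeta$ of the indicial equation $\zeta(\zeta-1)+A_1\zeta+A_2=0$, where $A_1=\lim_{s\to\tilde s}(s-\tilde s)a_1(s)$ and $A_2=\lim_{s\to\tilde s}(s-\tilde s)^2a_2(s)$. The indices at $\infty$ are the roots $\zeta$ of $\zeta(\zeta+1)-\tilde A_1\zeta+\tilde A_2=0$, where $\tilde A_1=\lim_{s\to\infty}s\,a_1(s)$ and $\tilde A_2=\lim_{s\to\infty}s^2a_2(s)$. The function $\rho_Q$ is the density of the limiting root-counting measure of the scaled spectral polynomials of the Lamé equation with singularities $e_1,e_2,e_3$. *)

theory Defs
  imports "HOL-Analysis.Analysis" "HOL-Computational_Algebra.Computational_Algebra"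
begin

(* Polymorphic in the argument: the differential equation is considered on real intervals,
   its singular points and indices on the complex plane. *)
definition lame_cubic ::
  "real \<Rightarrow> real \<Rightarrow> real \<Rightarrow> 'a \<Rightarrow> 'a::real_normed_field" where
  "lame_cubic e1 e2 e3 s = (s - of_real e1) * (s - of_real e2) * (s - of_real e3)"

(* The integrands are unbounded at both end points but Lebesgue integrable.
   No value is prescribed outside the two open intervals. *)
definition rho_Q :: "real \<Rightarrow> real \<Rightarrow> real \<Rightarrow> real \<Rightarrow> real" where
  "rho_Q e1 e2 e3 s =
     (if e3 < s \<and> s < e2 then
        1 / (2 * pi) * (LINT x:{e2..e1}|lborel. 1 / sqrt ((e1 - x) * (x - e2) * (x - e3) * (x - s)))
      else if e2 < s \<and> s < e1 then
        1 / (2 * pi) * (LINT x:{e3..e2}|lborel. 1 / sqrt ((e1 - x) * (e2 - x) * (x - e3) * (s - x)))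
      else undefined)"

(* y is a solution of p0 y'' + p1 y' + p2 y = 0 on the open set S. *)
definition solves_linear_ode2_on ::
  "(real \<Rightarrow> real) \<Rightarrow> (real \<Rightarrow> real) \<Rightarrow> (real \<Rightarrow> real) \<Rightarrow> (real \<Rightarrow> real) \<Rightarrow> real set \<Rightarrow> bool" where
  "solves_linear_ode2_on p0 p1 p2 y S \<longleftrightarrow>
     (\<exists>y' y''. \<forall>s\<in>S. (y has_real_derivative y' s) (at s) \<and>
        (y' has_real_derivative y'' s) (at s) \<and>
        p0 s * y'' s + p1 s * y' s + p2 s * y s = 0)"

definition coeff0 :: "real \<Rightarrow> real \<Rightarrow> real \<Rightarrow> 'a \<Rightarrow> 'a::real_normed_field" where
  "coeff0 e1 e2 e3 s = 8 * lame_cubic e1 e2 e3 s"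

definition coeff1 :: "real \<Rightarrow> real \<Rightarrow> real \<Rightarrow> 'a \<Rightarrow> 'a::real_normed_field" where
  "coeff1 e1 e2 e3 s = 8 * deriv (lame_cubic e1 e2 e3) s"

definition coeff2 :: "real \<Rightarrow> real \<Rightarrow> real \<Rightarrow> 'a \<Rightarrow> 'a::real_normed_field" where
  "coeff2 e1 e2 e3 s = deriv (deriv (lame_cubic e1 e2 e3)) s"

(* From here on a pair (a1, a2) stands for the equation y'' + a1 y' + a2 y = 0 in a complex
   variable; values of a1 and a2 at isolated points (such as poles) are irrelevant. *)

definition extends_analytically_at :: "(complex \<Rightarrow> complex) \<Rightarrow> complex \<Rightarrow> bool" where
  "extends_analytically_at f z \<longleftrightarrow>
     (\<exists>g. g analytic_on {z} \<and> (\<forall>\<^sub>F w in at z. f w = g w))"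

definition ordinary_point ::
  "(complex \<Rightarrow> complex) \<Rightarrow> (complex \<Rightarrow> complex) \<Rightarrow> complex \<Rightarrow> bool" where
  "ordinary_point a1 a2 z \<longleftrightarrow> extends_analytically_at a1 z \<and> extends_analytically_at a2 z"

definition regular_singular_point ::
  "(complex \<Rightarrow> complex) \<Rightarrow> (complex \<Rightarrow> complex) \<Rightarrow> complex \<Rightarrow> bool" where
  "regular_singular_point a1 a2 z \<longleftrightarrow>
     \<not> ordinary_point a1 a2 z \<and>
     extends_analytically_at (\<lambda>w. (w - z) * a1 w) z \<and>
     extends_analytically_at (\<lambda>w. (w - z)^2 * a2 w) z"

(* The substitution s = 1/w turns y'' + a1 y' + a2 y = 0 into the equation with the coefficients
   below, and infinity into w = 0. *)
definition regular_singular_at_infinity ::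
  "(complex \<Rightarrow> complex) \<Rightarrow> (complex \<Rightarrow> complex) \<Rightarrow> bool" where
  "regular_singular_at_infinity a1 a2 \<longleftrightarrow>
     regular_singular_point (\<lambda>w. 2 / w - a1 (1 / w) / w^2) (\<lambda>w. a2 (1 / w) / w^4) 0"

(* Heun equation with finite singularities c1, c2, c3 in general position; alpha and beta are
   its indices at infinity, and the linear relation is the Fuchs relation. *)
definition heun_equation ::
  "complex \<Rightarrow> complex \<Rightarrow> complex \<Rightarrow> (complex \<Rightarrow> complex) \<Rightarrow> (complex \<Rightarrow> complex) \<Rightarrow> bool" where
  "heun_equation c1 c2 c3 a1 a2 \<longleftrightarrow> distinct [c1, c2, c3] \<and>
     (\<exists>\<gamma>1 \<gamma>2 \<gamma>3 \<alpha> \<beta> q. \<gamma>1 + \<gamma>2 + \<gamma>3 = \<alpha> + \<beta> + 1 \<and>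
        (\<forall>s. s \<notin> {c1, c2, c3} \<longrightarrow>
           a1 s = \<gamma>1 / (s - c1) + \<gamma>2 / (s - c2) + \<gamma>3 / (s - c3) \<and>
           a2 s = (\<alpha> * \<beta> * s - q) / ((s - c1) * (s - c2) * (s - c3))))"

definition indicial_poly :: "complex \<Rightarrow> complex \<Rightarrow> complex poly" where
  "indicial_poly A1 A2 = [:0, 1:] * ([:0, 1:] - 1) + [:A1:] * [:0, 1:] + [:A2:]"

definition indicial_poly_infinity :: "complex \<Rightarrow> complex \<Rightarrow> complex poly" where
  "indicial_poly_infinity A1 A2 = [:0, 1:] * ([:0, 1:] + 1) - [:A1:] * [:0, 1:] + [:A2:]"

(* Indices form a multiset, so that a double root is recorded as such. *)
definition has_indices_at ::
  "(complex \<Rightarrow> complex) \<Rightarrow> (complex \<Rightarrow> complex) \<Rightarrow> complex multiset \<Rightarrow> complex \<Rightarrow> bool" where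
  "has_indices_at a1 a2 Z z \<longleftrightarrow>
     (\<exists>A1 A2. ((\<lambda>s. (s - z) * a1 s) \<longlongrightarrow> A1) (at z) \<and>
        ((\<lambda>s. (s - z)^2 * a2 s) \<longlongrightarrow> A2) (at z) \<and>
        Z = proots (indicial_poly A1 A2))"

definition has_indices_at_infinity ::
  "(complex \<Rightarrow> complex) \<Rightarrow> (complex \<Rightarrow> complex) \<Rightarrow> complex multiset \<Rightarrow> bool" where
  "has_indices_at_infinity a1 a2 Z \<longleftrightarrow>
     (\<exists>A1 A2. ((\<lambda>s. s * a1 s) \<longlongrightarrow> A1) at_infinity \<and>
        ((\<lambda>s. s^2 * a2 s) \<longlongrightarrow> A2) at_infinity \<and>
        Z = proots (indicial_poly_infinity A1 A2))"

definition normal_coeff1 :: "real \<Rightarrow> real \<Rightarrow> real \<Rightarrow> complex \<Rightarrow> complex" where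
  "normal_coeff1 e1 e2 e3 s = coeff1 e1 e2 e3 s / coeff0 e1 e2 e3 s"

definition normal_coeff2 :: "real \<Rightarrow> real \<Rightarrow> real \<Rightarrow> complex \<Rightarrow> complex" where
  "normal_coeff2 e1 e2 e3 s = coeff2 e1 e2 e3 s / coeff0 e1 e2 e3 s"

end

theory Submission
  imports Defs
begin

text \<open>
  Substituting \<open>x = e2 + (e1 - e2) sin\<^sup>2 t\<close> turns the integral for \<open>s < e2\<close> into an integral over
  \<open>[0, \<pi>/2]\<close> with a smooth integrand, which can be differentiated twice under the integral sign.
  In terms of \<open>u = x - s\<close> and up to a constant factor, the Heun operator then turns the integrand
  into \<open>(6 Q(s) + 4 Q'(s) u + Q''(s) u\<^sup>2) u\<^bsup>-5/2\<^esup> \<bar>Q(x)\<bar>\<^bsup>-1/2\<^esup>\<close>. Expanding \<open>Q(x) = Q(s + u)\<close> in powers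
  of \<open>u\<close> shows that this is the \<open>x\<close>-derivative of \<open>4 \<bar>Q(x)\<bar>\<^bsup>1/2\<^esup> u\<^bsup>-3/2\<^esup>\<close>, which vanishes at both
  end points. The reflection \<open>x \<mapsto> - x\<close> reduces the interval \<open>(e2, e1)\<close> to this case.
\<close>

text \<open>Kept over any real normed field: the differential equation uses it over the reals, the
  singular points and indices over the complex numbers.\<close>

lemma lame_cubic_derivs:
  fixes s :: "'a::real_normed_field"
  shows "deriv (lame_cubic e1 e2 e3) s = (s - of_real e2) * (s - of_real e3) +
      (s - of_real e1) * (s - of_real e3) + (s - of_real e1) * (s - of_real e2)" (is ?A)
    and "deriv (deriv (lame_cubic e1 e2 e3)) s =
      6 * s - 2 * (of_real e1 + of_real e2 + of_real e3 :: 'a)" (is ?B)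
proof -
  have A: "deriv (lame_cubic e1 e2 e3) = (\<lambda>s::'a. (s - of_real e2) * (s - of_real e3) +
      (s - of_real e1) * (s - of_real e3) + (s - of_real e1) * (s - of_real e2))"
    unfolding lame_cubic_def
    by (intro ext DERIV_imp_deriv) (auto intro!: derivative_eq_intros simp: algebra_simps)
  then show ?A by simp
  show ?B
    unfolding A
    by (intro DERIV_imp_deriv) (auto intro!: derivative_eq_intros simp: algebra_simps)
qed

section \<open>Moments: the substituted integral, its derivatives and their linear relation\<close>

definition subst_pt :: "real \<Rightarrow> real \<Rightarrow> real \<Rightarrow> real" where
  "subst_pt e1 e2 t = e2 + (e1 - e2) * (sin t)\<^sup>2"

text \<open>For \<open>p = - 1/2\<close> this is half the transformed integrand: \<open>dx\<close>
  cancels the roots of \<open>e1 - x\<close> and \<open>x - e2\<close>, hence the end point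
  singularities. The exponent \<open>p\<close> is free because each \<open>s\<close>-derivative
  lowers it by one.\<close>

definition lame_kernel :: "real \<Rightarrow> real \<Rightarrow> real \<Rightarrow> real \<Rightarrow> real \<Rightarrow> real \<Rightarrow> real" where
  "lame_kernel e1 e2 e3 p s t =
     (subst_pt e1 e2 t - s) powr p / sqrt (subst_pt e1 e2 t - e3)"

definition moment :: "real \<Rightarrow> real \<Rightarrow> real \<Rightarrow> real \<Rightarrow> real \<Rightarrow> real" where
  "moment e1 e2 e3 p s = integral {0..pi/2} (lame_kernel e1 e2 e3 p s)"

lemma subst_pt_ge: "e1 > e2 \<Longrightarrow> subst_pt e1 e2 t \<ge> e2"
  by (simp add: subst_pt_def)

text \<open>Since \<open>x\<close> stays in \<open>[e2, e1]\<close>, both \<open>x - s\<close> and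
  \<open>x - e3\<close> are bounded away from zero for each \<open>s < e2\<close>. Joint continuity
  is what differentiation under the integral sign requires.\<close>

lemma continuous_on_lame_kernel:
  assumes "e1 > e2" "e2 > e3"
  shows "continuous_on ({..<e2} \<times> X) (\<lambda>(s, t). lame_kernel e1 e2 e3 p s t)"
proof -
  have nz: "subst_pt e1 e2 t \<noteq> s" if "s < e2" for s t
    using subst_pt_ge[OF assms(1), of t] that by linarith
  have c: "continuous_on A (\<lambda>z. subst_pt e1 e2 (snd z))" for A :: "(real \<times> real) set"
    unfolding subst_pt_def by (intro continuous_intros)
  show ?thesis
    unfolding case_prod_beta lame_kernel_def
    by (intro continuous_intros c) (auto simp: nz assms)
qed

lemma continuous_on_lame_kernel_slice:
  assumes "e1 > e2" "e2 > e3" "s < e2"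
  shows "continuous_on X (lame_kernel e1 e2 e3 p s)"
proof -
  have "continuous_on X (\<lambda>t. (s, t))" "(\<lambda>t. (s, t)) ` X \<subseteq> {..<e2} \<times> X"
    using assms(3) by (auto intro: continuous_intros)
  from continuous_on_compose2[OF continuous_on_lame_kernel[OF assms(1,2), of X p] this]
  show ?thesis by simp
qed

text \<open>Leibniz rule; the sign comes from differentiating \<open>x - s\<close> in
  \<open>s\<close>. The parameter set \<open>{..<e2}\<close> is convex, as the rule demands, and
  open, so the derivative within it is an ordinary one.\<close>

lemma moment_has_derivative:
  assumes "e1 > e2" "e2 > e3" "s < e2"
  shows "(moment e1 e2 e3 p has_real_derivative - p * moment e1 e2 e3 (p - 1) s) (at s)"
proof -
  have "((\<lambda>s. integral (cbox 0 (pi/2)) (lame_kernel e1 e2 e3 p s)) has_field_derivative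
      integral (cbox 0 (pi/2)) (\<lambda>t. - p * lame_kernel e1 e2 e3 (p - 1) s t)) (at s within {..<e2})"
  proof (rule leibniz_rule_field_derivative[where fx = "\<lambda>s t. - p * lame_kernel e1 e2 e3 (p - 1) s t"])
    fix x t :: real
    assume "x \<in> {..<e2}"
    with subst_pt_ge[OF assms(1), of t] have "subst_pt e1 e2 t - x > 0" by simp
    then have "((\<lambda>x. (subst_pt e1 e2 t - x) powr p) has_real_derivative
        p * (subst_pt e1 e2 t - x) powr (p - 1) * (0 - 1)) (at x)"
      by (rule DERIV_chain2[OF has_real_derivative_powr DERIV_diff[OF DERIV_const DERIV_ident]])
    from DERIV_cdivide[OF this, of "sqrt (subst_pt e1 e2 t - e3)"]
    show "((\<lambda>x. lame_kernel e1 e2 e3 p x t) has_field_derivative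
        - p * lame_kernel e1 e2 e3 (p - 1) x t) (at x within {..<e2})"
      unfolding lame_kernel_def by (auto dest: has_field_derivative_at_within[where s = "{..<e2}"])
  next
    show "lame_kernel e1 e2 e3 p x integrable_on cbox 0 (pi/2)" if "x \<in> {..<e2}" for x
      by (intro integrable_continuous continuous_on_lame_kernel_slice) (use assms that in auto)
  next
    have "continuous_on ({..<e2} \<times> cbox 0 (pi/2)) (\<lambda>z. - p * (case z of (s, t) \<Rightarrow> lame_kernel e1 e2 e3 (p - 1) s t))"
      by (intro continuous_intros continuous_on_lame_kernel assms)
    then show "continuous_on ({..<e2} \<times> cbox 0 (pi/2)) (\<lambda>(s, t). - p * lame_kernel e1 e2 e3 (p - 1) s t)"
      by (simp add: case_prod_beta)
  qed (use assms in auto)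
  then show ?thesis
    using assms(3) by (simp add: moment_def[abs_def] at_within_open[of s "{..<e2}"])
qed

text \<open>This is the Heun equation for the moment with \<open>p = - 1/2\<close>: its first two
  derivatives carry the factors 1/2 and 3/4, and 8 * 3/4 = 6, 8 * 1/2 = 4.\<close>

lemma moment_relation:
  fixes e1 e2 e3 s :: real
  assumes "e1 > e2" "e2 > e3" "s < e2"
  defines "Q \<equiv> lame_cubic e1 e2 e3"
  shows "6 * Q s * moment e1 e2 e3 (- 5/2) s + 4 * deriv Q s * moment e1 e2 e3 (- 3/2) s +
    deriv (deriv Q) s * moment e1 e2 e3 (- 1/2) s = 0"
proof -
  let ?K = "lame_kernel e1 e2 e3" and ?x = "subst_pt e1 e2"
  \<comment> \<open>\<open>G t = 2 \<bar>Q(x)\<bar>\<^bsup>1/2\<^esup> u\<^bsup>-3/2\<^esup>\<close>; the missing factor 2 is that of \<open>dx = 2 \<bar>(e1 - x) (x - e2)\<bar>\<^bsup>1/2\<^esup> dt\<close>.\<close>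
  define G where "G t = 2 * (e1 - e2) * (sin t * cos t) * sqrt (?x t - e3) * (?x t - s) powr (- 3/2)" for t
  define g where "g t = 6 * Q s * ?K (- 5/2) s t + 4 * deriv Q s * ?K (- 3/2) s t +
    deriv (deriv Q) s * ?K (- 1/2) s t" for t
  have dG: "(G has_real_derivative g t) (at t)" for t
  proof -
    \<comment> \<open>On \<open>[e2, e1]\<close> one has \<open>|Q(x)| = M^2 * v\<close>. Unlike the
      root of \<open>(e1 - x) * (x - e2)\<close>, its signed version \<open>M\<close> is smooth in
      \<open>t\<close> also at the ends.\<close>
    define M where "M = (e1 - e2) * (sin t * cos t)"
    define v where "v = ?x t - e3"
    define u where "u = ?x t - s"
    have pos: "v > 0" "u > 0"
      using subst_pt_ge[OF assms(1), of t] assms by (auto simp: u_def v_def)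
    have dx: "(?x has_real_derivative 2 * M) (at t)"
      unfolding subst_pt_def[abs_def] M_def by (auto intro!: derivative_eq_intros)
    have c2: "(cos t)\<^sup>2 = 1 - (sin t)\<^sup>2"
      by (simp add: cos_squared_eq)
    have dM: "((\<lambda>t. (e1 - e2) * (sin t * cos t)) has_real_derivative e1 + e2 - 2 * ?x t) (at t)"
      by (auto intro!: derivative_eq_intros simp: subst_pt_def c2 power2_eq_square[symmetric])
        (simp add: algebra_simps)
    have M2: "M\<^sup>2 = (e1 - ?x t) * (?x t - e2)"
      by (simp add: M_def power_mult_distrib c2 subst_pt_def) algebra
    \<comment> \<open>Common factor of the three kernels; with it the claim \<open>G' = g\<close>
      becomes an identity between polynomials.\<close>
    define r where "r = u powr (- 5/2) / sqrt v"
    have k: "?K (- 5/2) s t = r" "?K (- 3/2) s t = r * u" "?K (- 1/2) s t = r * u\<^sup>2"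
      using pos powr_add[of u "-5/2" 1] powr_add[of u "-5/2" 2]
      by (simp_all add: lame_kernel_def r_def u_def[symmetric] v_def[symmetric])
    have "(G has_real_derivative 2 * ((e1 + e2 - 2 * ?x t) * sqrt v * u powr (- 3/2) +
        M * (2 * M * (inverse (sqrt v) / 2)) * u powr (- 3/2)
        + M * sqrt v * (- 3/2 * u powr (- 5/2) * (2 * M)))) (at t)"
    proof -
      have a: "((\<lambda>t. sqrt (?x t - e3)) has_real_derivative 2 * M * (inverse (sqrt v) / 2)) (at t)"
        using DERIV_chain2[OF DERIV_real_sqrt[OF pos(1)[unfolded v_def]] DERIV_diff[OF dx DERIV_const[of e3]]]
        by (simp add: v_def mult.commute)
      have b: "((\<lambda>t. (?x t - s) powr (- 3/2)) has_real_derivative - 3/2 * u powr (- 5/2) * (2 * M)) (at t)"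
        using DERIV_chain2[OF has_real_derivative_powr[OF pos(2)[unfolded u_def], of "-3/2"] DERIV_diff[OF dx DERIV_const[of s]]]
        by (simp add: u_def)
      show ?thesis
        using DERIV_cmult[OF DERIV_mult[OF DERIV_mult[OF dM a] b], of 2]
        unfolding G_def[abs_def] by (simp add: M_def u_def v_def algebra_simps)
    qed
    also have "2 * ((e1 + e2 - 2 * ?x t) * sqrt v * u powr (- 3/2) +
        M * (2 * M * (inverse (sqrt v) / 2)) * u powr (- 3/2)
        + M * sqrt v * (- 3/2 * u powr (- 5/2) * (2 * M)))
      = r * (2 * (e1 + e2 - 2 * ?x t) * v * u + 2 * M\<^sup>2 * u - 6 * M\<^sup>2 * v)"
    proof -
      have 1: "u powr (- 3/2) = r * sqrt v * u" "u powr (- 5/2) = r * sqrt v"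
        using pos powr_add[of u "-5/2" 1] by (simp_all add: r_def)
      \<comment> \<open>The root of \<open>v\<close> and its inverse enter the algebraic identity as
        unknowns bound by these two relations.\<close>
      have 2: "v = sqrt v * sqrt v" "sqrt v * inverse (sqrt v) = 1"
        using pos by simp_all
      show ?thesis unfolding 1 using 2 by algebra
    qed
    \<comment> \<open>The bracket equals \<open>6 Q(x) - 2 Q'(x) u\<close>, because
      \<open>Q(x) = - M^2 * v\<close>. In the Taylor expansion at \<open>s\<close> the terms in
      \<open>u^3\<close> cancel, which leaves
      \<open>6 Q(s) + 4 Q'(s) u + Q''(s) u^2\<close>.\<close>
    also have "\<dots> = g t"
      unfolding g_def k M2 Q_def lame_cubic_derivs unfolding lame_cubic_def u_def v_def
      by (simp, algebra)
    finally show ?thesis .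
  qed
  have "(g has_integral (G (pi/2) - G 0)) {0..pi/2}"
    by (rule fundamental_theorem_of_calculus)
      (auto intro: has_field_derivative_at_within[OF dG] simp: has_real_derivative_iff_has_vector_derivative[symmetric])
  moreover have "?K p s integrable_on {0..pi/2}" for p
    by (intro integrable_continuous_real continuous_on_lame_kernel_slice assms)
  then have "(g has_integral (6 * Q s * moment e1 e2 e3 (- 5/2) s + 4 * deriv Q s * moment e1 e2 e3 (- 3/2) s +
    deriv (deriv Q) s * moment e1 e2 e3 (- 1/2) s)) {0..pi/2}"
    unfolding g_def moment_def
    by (intro has_integral_add has_integral_mult_right integrable_integral)
  ultimately have "6 * Q s * moment e1 e2 e3 (- 5/2) s + 4 * deriv Q s * moment e1 e2 e3 (- 3/2) s +
    deriv (deriv Q) s * moment e1 e2 e3 (- 1/2) s = G (pi/2) - G 0"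
    using has_integral_unique by blast
  then show ?thesis by (simp add: G_def)
qed

section \<open>Reduction of the density integrals to moments\<close>

lemma lame_integral_eq_moment:
  fixes e1 e2 e3 s :: real
  assumes "e1 > e2" "e2 > e3" "s < e2"
  shows "(LINT x:{e2..e1}|lborel. 1 / sqrt ((e1 - x) * (x - e2) * (x - e3) * (x - s)))
    = 2 * moment e1 e2 e3 (- 1/2) s"
proof -
  let ?f = "\<lambda>x. 1 / sqrt ((e1 - x) * (x - e2) * (x - e3) * (x - s))"
  let ?x = "subst_pt e1 e2"
  let ?d = "\<lambda>t. 2 * (e1 - e2) * sin t * cos t"
  let ?K = "lame_kernel e1 e2 e3 (- 1/2) s"
  have sc: "sin t > 0" "cos t > 0" if "0 < t" "t < pi/2" for t
    using that by (auto intro!: sin_gt_zero cos_gt_zero)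
  have fx: "e1 - ?x t = (e1 - e2) * (cos t)\<^sup>2" "?x t - e2 = (e1 - e2) * (sin t)\<^sup>2" for t
    by (simp_all add: subst_pt_def cos_squared_eq algebra_simps)
  have pos: "?x t - e3 > 0" "?x t - s > 0" for t
    using subst_pt_ge[OF assms(1), of t] assms by auto
  \<comment> \<open>Only for interior \<open>t\<close>: at both ends the left side is 0, as
    \<open>1 / 0 = 0\<close>, while the kernel is positive.\<close>
  have fK: "?f (?x t) * ?d t = 2 * ?K t" if "0 < t" "t < pi/2" for t
  proof -
    have "(e1 - ?x t) * (?x t - e2) = ((e1 - e2) * sin t * cos t)\<^sup>2"
      unfolding fx by algebra
    then have root: "sqrt ((e1 - ?x t) * (?x t - e2) * (?x t - e3) * (?x t - s)) =
       (e1 - e2) * sin t * cos t * sqrt (?x t - e3) * sqrt (?x t - s)"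
      using sc[OF that] assms by (simp add: real_sqrt_mult)
    have pw: "(?x t - s) powr (- 1/2) = 1 / sqrt (?x t - s)"
      using pos(2)[of t] powr_minus_divide[of "?x t - s" "1/2"] powr_half_sqrt[of "?x t - s"] by simp
    have cancel: "1 / (m * a * b) * (2 * m) = 2 * (1 / b / a)" if "m \<noteq> 0" for m a b :: real
      using that by simp
    have nz: "(e1 - e2) * sin t * cos t \<noteq> 0"
      using sc[OF that] assms by simp
    show ?thesis
      unfolding lame_kernel_def root pw mult.assoc[of 2] by (rule cancel[OF nz])
  qed
  have intK: "set_integrable lborel {0..pi/2} (\<lambda>t. 2 * ?K t)"
    by (intro borel_integrable_atLeastAtMost' continuous_intros continuous_on_lame_kernel_slice assms)
  \<comment> \<open>The original integrand is unbounded at the ends, so the substitution runs over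
    open intervals and uses only limits there. As the integrand is nonnegative, integrability of the
    transformed one suffices.\<close>
  have subst: "(LBINT x=ereal e2..ereal e1. ?f x) = (LBINT t=ereal 0..ereal (pi/2). ?f (?x t) * ?d t)"
  proof (rule interval_integral_substitution_nonneg)
    show "(?x has_real_derivative ?d t) (at t)" for t
      unfolding subst_pt_def[abs_def] by (auto intro!: derivative_eq_intros)
    fix t assume "ereal 0 < ereal t" "ereal t < ereal (pi/2)"
    then have "(e1 - ?x t) * (?x t - e2) * (?x t - e3) * (?x t - s) > 0"
      unfolding fx using sc[of t] pos[of t] assms by simp
    then show "isCont ?f (?x t)" "0 \<le> ?f (?x t)"
      by (auto intro!: continuous_intros)
  next
    show "0 \<le> ?d t" if "ereal 0 \<le> ereal t" "ereal t \<le> ereal (pi/2)" for t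
      using that assms by (auto intro!: mult_nonneg_nonneg sin_ge_zero cos_ge_zero)
  next
    have c: "isCont ?x t" for t
      unfolding subst_pt_def by (intro continuous_intros)
    have "(?x \<longlongrightarrow> e2) (at_right 0)" "(?x \<longlongrightarrow> e1) (at_left (pi/2))"
      using c[of 0] c[of "pi/2"] by (auto simp: isCont_def subst_pt_def filterlim_at_split)
    then show "((ereal \<circ> ?x \<circ> real_of_ereal) \<longlongrightarrow> ereal e2) (at_right (ereal 0))"
      "((ereal \<circ> ?x \<circ> real_of_ereal) \<longlongrightarrow> ereal e1) (at_left (ereal (pi/2)))"
      by (simp_all only: ereal_tendsto_simps1 ereal_tendsto_simps2)
  next
    have "set_integrable lborel {0<..<pi/2} (\<lambda>t. 2 * ?K t)"
      by (rule set_integrable_subset[OF intK]) auto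
    moreover have "set_integrable lborel {0<..<pi/2} (\<lambda>t. ?f (?x t) * ?d t) =
        set_integrable lborel {0<..<pi/2} (\<lambda>t. 2 * ?K t)"
      by (intro set_integrable_cong[OF refl refl] fK) simp_all
    ultimately show "set_integrable lborel (einterval (ereal 0) (ereal (pi/2))) (\<lambda>t. ?f (?x t) * ?d t)"
      by (simp only: einterval_eq)
  qed (auto intro!: continuous_intros)
  have "(LINT x:{e2..e1}|lborel. ?f x) = (LBINT x=ereal e2..ereal e1. ?f x)"
    using assms by (subst interval_integral_Icc) auto
  also note subst
  also have "(LBINT t=ereal 0..ereal (pi/2). ?f (?x t) * ?d t) = (LBINT t=ereal 0..ereal (pi/2). 2 * ?K t)"
    by (intro interval_integral_cong fK) (auto simp: min_def max_def split: if_splits)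
  also have "\<dots> = integral {0..pi/2} (\<lambda>t. 2 * ?K t)"
    by (rule interval_integral_eq_integral) (use intK in auto)
  also have "\<dots> = 2 * moment e1 e2 e3 (- 1/2) s"
    by (simp add: moment_def)
  finally show ?thesis .
qed

text \<open>Reflection turns \<open>(e1, e2, e3, s)\<close> into
  \<open>(- e3, - e2, - e1, - s)\<close>. The singularities stay in decreasing order and
  \<open>s > e2\<close> becomes \<open>- s < - e2\<close>, the case already treated.\<close>

lemma lame_integral_reflect:
  fixes e1 e2 e3 s :: real
  assumes "e3 \<le> e2"
  shows "(LINT x:{e3..e2}|lborel. 1 / sqrt ((e1 - x) * (e2 - x) * (x - e3) * (s - x))) =
    (LINT x:{- e2..- e3}|lborel. 1 / sqrt ((- e3 - x) * (x - (- e2)) * (x - (- e1)) * (x - (- s))))"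
proof -
  let ?f = "\<lambda>x. 1 / sqrt ((e1 - x) * (e2 - x) * (x - e3) * (s - x))"
  let ?g = "\<lambda>x. 1 / sqrt ((- e3 - x) * (x - (- e2)) * (x - (- e1)) * (x - (- s)))"
  have fg: "?f (- x) = ?g x" for x
  proof -
    have "(e1 - (- x)) * (e2 - (- x)) * (- x - e3) * (s - (- x)) =
        (- e3 - x) * (x - (- e2)) * (x - (- e1)) * (x - (- s))"
      by algebra
    then show ?thesis by (rule arg_cong)
  qed
  have "(LINT x:{e3..e2}|lborel. ?f x) = (LBINT x=ereal e3..ereal e2. ?f x)"
    using assms by (rule interval_integral_Icc[symmetric])
  also have "\<dots> = (LBINT x=ereal (- e2)..ereal (- e3). ?f (- x))"
    using interval_integral_reflect[of "ereal e3" "ereal e2" ?f] by simp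
  also have "\<dots> = (LINT x:{- e2..- e3}|lborel. ?g x)"
    unfolding fg using assms by (intro interval_integral_Icc) simp
  finally show ?thesis .
qed

section \<open>The Heun equation on the two intervals\<close>

lemma moment_solves_ode:
  assumes "e1 > e2" "e2 > e3"
  shows "solves_linear_ode2_on (coeff0 e1 e2 e3) (coeff1 e1 e2 e3) (coeff2 e1 e2 e3)
    (moment e1 e2 e3 (- 1/2)) {..<e2}"
  unfolding solves_linear_ode2_on_def
proof (intro exI ballI conjI)
  fix s assume "s \<in> {..<e2}"
  then have s: "s < e2" by simp
  show "(moment e1 e2 e3 (- 1/2) has_real_derivative 1/2 * moment e1 e2 e3 (- 3/2) s) (at s)"
    using moment_has_derivative[OF assms s, of "-1/2"] by simp
  show "((\<lambda>s. 1/2 * moment e1 e2 e3 (- 3/2) s) has_real_derivative 3/4 * moment e1 e2 e3 (- 5/2) s) (at s)"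
    using DERIV_cmult[OF moment_has_derivative[OF assms s, of "-3/2"], of "1/2"] by simp
  show "coeff0 e1 e2 e3 s * (3/4 * moment e1 e2 e3 (- 5/2) s) +
      coeff1 e1 e2 e3 s * (1/2 * moment e1 e2 e3 (- 3/2) s) +
      coeff2 e1 e2 e3 s * moment e1 e2 e3 (- 1/2) s = 0"
    using moment_relation[OF assms s] by (simp add: coeff0_def coeff1_def coeff2_def)
qed

text \<open>Linearity allows the factor \<open>c\<close>. Openness of \<open>S\<close> lets
  \<open>z\<close> inherit derivatives from an equality known only on \<open>S\<close>; for
  \<open>rho_Q\<close> nothing is prescribed outside the two intervals.\<close>

lemma solves_linear_ode2_on_transform:
  assumes "solves_linear_ode2_on p0 p1 p2 y T" "open S" "S \<subseteq> T"
    and "\<And>s. s \<in> S \<Longrightarrow> z s = c * y s"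
  shows "solves_linear_ode2_on p0 p1 p2 z S"
proof -
  obtain y' y'' where y: "\<And>s. s \<in> T \<Longrightarrow> (y has_real_derivative y' s) (at s)"
    "\<And>s. s \<in> T \<Longrightarrow> (y' has_real_derivative y'' s) (at s)"
    "\<And>s. s \<in> T \<Longrightarrow> p0 s * y'' s + p1 s * y' s + p2 s * y s = 0"
    using assms(1) unfolding solves_linear_ode2_on_def by blast
  show ?thesis
    unfolding solves_linear_ode2_on_def
  proof (intro exI ballI conjI)
    fix s assume s: "s \<in> S"
    then have t: "s \<in> T" using assms(3) by auto
    show "(z has_real_derivative c * y' s) (at s)"
      by (rule has_field_derivative_transform_within_open[OF DERIV_cmult[OF y(1)[OF t]] assms(2) s])
        (simp add: assms(4))
    show "((\<lambda>s. c * y' s) has_real_derivative c * y'' s) (at s)"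
      by (rule DERIV_cmult[OF y(2)[OF t]])
    have "p0 s * (c * y'' s) + p1 s * (c * y' s) + p2 s * (c * y s) =
        c * (p0 s * y'' s + p1 s * y' s + p2 s * y s)"
      by (simp add: algebra_simps)
    then show "p0 s * (c * y'' s) + p1 s * (c * y' s) + p2 s * z s = 0"
      using assms(4)[OF s] y(3)[OF t] by simp
  qed
qed

text \<open>For the reflected data, the cubic and its second derivative at \<open>- s\<close> are
  \<open>- Q(s)\<close> and \<open>- Q''(s)\<close>, while the first derivative is
  \<open>Q'(s)\<close>. As \<open>y(- s)\<close> has derivative \<open>- y'(- s)\<close>, the whole
  equation just changes sign.\<close>

lemma solves_lame_reflect:
  fixes e1 e2 e3 :: real
  assumes "solves_linear_ode2_on (coeff0 (- e3) (- e2) (- e1)) (coeff1 (- e3) (- e2) (- e1))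
    (coeff2 (- e3) (- e2) (- e1)) y S"
  shows "solves_linear_ode2_on (coeff0 e1 e2 e3) (coeff1 e1 e2 e3) (coeff2 e1 e2 e3)
    (\<lambda>s. y (- s)) (uminus ` S)"
proof -
  obtain y' y'' where y: "\<And>s. s \<in> S \<Longrightarrow> (y has_real_derivative y' s) (at s)"
    "\<And>s. s \<in> S \<Longrightarrow> (y' has_real_derivative y'' s) (at s)"
    "\<And>s. s \<in> S \<Longrightarrow> coeff0 (- e3) (- e2) (- e1) s * y'' s +
       coeff1 (- e3) (- e2) (- e1) s * y' s + coeff2 (- e3) (- e2) (- e1) s * y s = 0"
    using assms unfolding solves_linear_ode2_on_def by blast
  show ?thesis
    unfolding solves_linear_ode2_on_def
  proof (intro exI ballI conjI)
    fix s assume "s \<in> uminus ` S"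
    then have s: "- s \<in> S" by auto
    show "((\<lambda>s. y (- s)) has_real_derivative - y' (- s)) (at s)"
      using y(1)[OF s] by (simp add: DERIV_mirror)
    show "((\<lambda>s. - y' (- s)) has_real_derivative y'' (- s)) (at s)"
      using DERIV_minus[of "\<lambda>s. y' (- s)" "- y'' (- s)"] y(2)[OF s] by (simp add: DERIV_mirror)
    show "coeff0 e1 e2 e3 s * y'' (- s) + coeff1 e1 e2 e3 s * (- y' (- s)) + coeff2 e1 e2 e3 s * y (- s) = 0"
      using y(3)[OF s]
      unfolding coeff0_def coeff1_def coeff2_def lame_cubic_derivs unfolding lame_cubic_def
      by (simp, algebra)
  qed
qed

lemma rho_Q_solves_left:
  assumes "e1 > e2" "e2 > e3"
  shows "solves_linear_ode2_on (coeff0 e1 e2 e3) (coeff1 e1 e2 e3) (coeff2 e1 e2 e3)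
    (rho_Q e1 e2 e3) {e3<..<e2}"
  \<comment> \<open>The constant is the prefactor \<open>1 / (2 * pi)\<close> times the 2 from
    \<open>lame_integral_eq_moment\<close>.\<close>
  by (rule solves_linear_ode2_on_transform[OF moment_solves_ode[OF assms], where c = "1 / pi"])
    (auto simp: rho_Q_def lame_integral_eq_moment[OF assms])

lemma rho_Q_solves_right:
  assumes "e1 > e2" "e2 > e3"
  shows "solves_linear_ode2_on (coeff0 e1 e2 e3) (coeff1 e1 e2 e3) (coeff2 e1 e2 e3)
    (rho_Q e1 e2 e3) {e2<..<e1}"
proof -
  have m: "- e3 > - e2" "- e2 > - e1" using assms by auto
  show ?thesis
  proof (rule solves_linear_ode2_on_transform[OF solves_lame_reflect[OF moment_solves_ode[OF m]]])
    show "{e2<..<e1} \<subseteq> uminus ` {..<- e2}"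
      by (auto intro!: image_eqI[where x = "- s" for s])
    show "rho_Q e1 e2 e3 s = 1 / pi * moment (- e3) (- e2) (- e1) (- 1/2) (- s)"
      if "s \<in> {e2<..<e1}" for s
      using that by (simp add: rho_Q_def lame_integral_reflect[OF less_imp_le[OF assms(2)]]
          lame_integral_eq_moment[OF m, of "- s", simplified])
  qed auto
qed

section \<open>Singular points and indices in the complex domain\<close>

lemma eventually_at_notin_finite:
  fixes z :: "'a::t1_space"
  shows "finite S \<Longrightarrow> \<forall>\<^sub>F w in at z. w \<notin> S"
  using islimpt_finite[of S z] by (simp add: islimpt_iff_eventually)

lemma extends_analytically_atI:
  assumes "g analytic_on {z}" "\<And>w. w \<notin> S \<Longrightarrow> f w = g w" "finite S"
  shows "extends_analytically_at f z"
proof -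
  have "\<forall>\<^sub>F w in at z. f w = g w"
    using eventually_at_notin_finite[OF assms(3)]
    by eventually_elim (rule assms(2))
  with assms(1) show ?thesis
    unfolding extends_analytically_at_def by blast
qed

text \<open>An analytic extension of \<open>a\<close> would be bounded near \<open>z\<close> and
  force the limit to be 0. This is how points are shown to be genuinely singular.\<close>

lemma not_extends_analytically_at_simple_pole:
  assumes "((\<lambda>w. (w - z) * a w) \<longlongrightarrow> A) (at z)" "A \<noteq> 0"
  shows "\<not> extends_analytically_at a z"
proof
  assume "extends_analytically_at a z"
  then obtain g where g: "g analytic_on {z}" "\<forall>\<^sub>F w in at z. a w = g w"
    unfolding extends_analytically_at_def by blast
  have "(g \<longlongrightarrow> g z) (at z)"
    using analytic_at_imp_isCont[OF g(1)] by (simp add: isCont_def)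
  then have "((\<lambda>w. (w - z) * g w) \<longlongrightarrow> (z - z) * g z) (at z)"
    by (intro tendsto_intros)
  moreover have "\<forall>\<^sub>F w in at z. (w - z) * g w = (w - z) * a w"
    using g(2) by eventually_elim simp
  ultimately have "((\<lambda>w. (w - z) * a w) \<longlongrightarrow> 0) (at z)"
    using Lim_transform_eventually by fastforce
  with assms show False
    using tendsto_unique[of "at z"] by auto
qed

text \<open>Lets the function \<open>g\<close> that witnesses regularity of a singular point also
  supply the limit that defines the indices.\<close>

lemma tendsto_at_eq_analytic:
  assumes "g analytic_on {z}" "\<And>w. w \<notin> S \<Longrightarrow> f w = g w" "finite S"
  shows "(f \<longlongrightarrow> g z) (at z)"
proof -
  have "\<forall>\<^sub>F w in at z. g w = f w"
    using eventually_at_notin_finite[OF assms(3)]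
    by eventually_elim (simp add: assms(2))
  moreover have "(g \<longlongrightarrow> g z) (at z)"
    using analytic_at_imp_isCont[OF assms(1)] by (simp add: isCont_def)
  ultimately show ?thesis
    by (rule Lim_transform_eventually[rotated])
qed

lemma proots_quadratic: "proots ([:- a, 1:] * [:- b, 1:] :: complex poly) = {#a, b#}"
  by (subst proots_mult) auto

text \<open>Partial fraction form of the normalised equation, symmetric in the three points, so that
  treating \<open>c1\<close> covers all of them. The indices do not depend on the accessory
  parameter \<open>q\<close>.\<close>

locale lame_coeffs =
  fixes c1 c2 c3 q :: complex and a1 a2 :: "complex \<Rightarrow> complex"
  assumes a1: "\<And>s. s \<notin> {c1, c2, c3} \<Longrightarrow> a1 s = 1 / (s - c1) + 1 / (s - c2) + 1 / (s - c3)"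
    and a2: "\<And>s. s \<notin> {c1, c2, c3} \<Longrightarrow> a2 s = (3/4 * s - q) / ((s - c1) * (s - c2) * (s - c3))"
begin

text \<open>Both coefficients have at most a simple pole at \<open>c1\<close>, that of
  \<open>a1\<close> with residue 1. The indicial polynomial is therefore
  \<open>z * (z - 1) + z = z^2\<close>, with double root 0.\<close>

lemma finite_singularity:
  assumes "c1 \<noteq> c2" "c1 \<noteq> c3"
  shows "regular_singular_point a1 a2 c1 \<and> has_indices_at a1 a2 {#0, 0#} c1"
proof -
  define g where "g s = 1 + (s - c1) / (s - c2) + (s - c1) / (s - c3)" for s
  define h where "h s = (s - c1) * (3/4 * s - q) / ((s - c2) * (s - c3))" for s
  have g: "g analytic_on {c1}" and h: "h analytic_on {c1}"
    unfolding g_def h_def using assms by (auto intro!: analytic_intros)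
  have a1': "(s - c1) * a1 s = g s" and a2': "(s - c1)\<^sup>2 * a2 s = h s" if "s \<notin> {c1, c2, c3}" for s
  proof -
    have "d * (1 / d + b + c) = 1 + d * b + d * c" "d\<^sup>2 * (n / (d * b * c)) = d * n / (b * c)"
      if "d \<noteq> 0" for d b c n :: complex
      using that by (simp_all add: algebra_simps power2_eq_square)
    then show "(s - c1) * a1 s = g s" "(s - c1)\<^sup>2 * a2 s = h s"
      using that a1[OF that] a2[OF that] by (simp_all add: g_def h_def)
  qed
  have fin: "finite {c1, c2, c3}" by simp
  have l1: "((\<lambda>s. (s - c1) * a1 s) \<longlongrightarrow> 1) (at c1)"
    using tendsto_at_eq_analytic[OF g a1' fin] by (simp add: g_def)
  have l2: "((\<lambda>s. (s - c1)\<^sup>2 * a2 s) \<longlongrightarrow> 0) (at c1)"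
    using tendsto_at_eq_analytic[OF h a2' fin] by (simp add: h_def)
  have "indicial_poly 1 0 = [:- 0, 1:] * [:- 0, 1:]"
    by (simp add: indicial_poly_def one_pCons)
  then have "has_indices_at a1 a2 {#0, 0#} c1"
    unfolding has_indices_at_def using l1 l2 proots_quadratic by metis
  moreover have "regular_singular_point a1 a2 c1"
    unfolding regular_singular_point_def ordinary_point_def
    using not_extends_analytically_at_simple_pole[OF l1]
      extends_analytically_atI[OF g a1' fin] extends_analytically_atI[OF h a2' fin] by auto
  ultimately show ?thesis by blast
qed

lemma ordinary:
  assumes "z \<notin> {c1, c2, c3}"
  shows "ordinary_point a1 a2 z"
proof -
  have "(\<lambda>s. 1 / (s - c1) + 1 / (s - c2) + 1 / (s - c3)) analytic_on {z}"
    "(\<lambda>s. (3/4 * s - q) / ((s - c1) * (s - c2) * (s - c3))) analytic_on {z}"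
    using assms by (auto intro!: analytic_intros)
  then show ?thesis
    unfolding ordinary_point_def
    using extends_analytically_atI[where S = "{c1, c2, c3}"] a1 a2 by auto
qed

text \<open>To leading order the coefficients are \<open>3 / s\<close> and
  \<open>(3/4) / s^2\<close>, and
  \<open>z * (z + 1) - 3 * z + 3/4 = (z - 1/2) * (z - 3/2)\<close>.\<close>

lemma infinity:
  "regular_singular_at_infinity a1 a2 \<and> has_indices_at_infinity a1 a2 {#1/2, 3/2#}"
proof -
  \<comment> \<open>The exceptional points in the coordinate \<open>w = 1 / s\<close>. If some
    \<open>ci\<close> is 0, then \<open>inverse 0 = 0\<close> only repeats the point 0.\<close>
  define S where "S = insert 0 (inverse ` {c1, c2, c3})"
  have S: "finite S" by (simp add: S_def)
  define g where "g w = 1 / (1 - c1 * w) + 1 / (1 - c2 * w) + 1 / (1 - c3 * w)" for w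
  define h where "h w = (3/4 - q * w) / ((1 - c1 * w) * (1 - c2 * w) * (1 - c3 * w))" for w
  have g: "g analytic_on {0}" and h: "h analytic_on {0}"
    unfolding g_def h_def by (auto intro!: analytic_intros)
  have nz: "w \<noteq> 0" "1 / w \<notin> {c1, c2, c3}" "1 - c1 * w \<noteq> 0" "1 - c2 * w \<noteq> 0" "1 - c3 * w \<noteq> 0"
    if "w \<notin> S" for w
  proof -
    have "1 / w \<noteq> c" "1 - c * w \<noteq> 0" if "w \<noteq> inverse c" for c
      using that inverse_unique[of c w] by (auto simp: inverse_eq_divide)
    with that show "w \<noteq> 0" "1 / w \<notin> {c1, c2, c3}" "1 - c1 * w \<noteq> 0" "1 - c2 * w \<noteq> 0" "1 - c3 * w \<noteq> 0"
      by (auto simp: S_def)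
  qed
  have inv: "1 / (1 / w - c) = w / (1 - c * w)" if "w \<noteq> 0" for w c :: complex
    using that by (simp add: divide_simps mult.commute)
  have b1: "a1 (1 / w) = w * g w" if "w \<notin> S" for w
    using a1[OF nz(2)[OF that]] inv[OF nz(1)[OF that]] by (simp add: g_def algebra_simps)
  have b2: "a2 (1 / w) = w\<^sup>2 * h w" if "w \<notin> S" for w
  proof -
    have "a2 (1 / w) = (3/4 / w - q) * (1 / (1 / w - c1)) * (1 / (1 / w - c2)) * (1 / (1 / w - c3))"
      using a2[OF nz(2)[OF that]] by simp
    also have "\<dots> = w\<^sup>2 * h w"
      unfolding inv[OF nz(1)[OF that]] h_def using nz[OF that]
      by (simp add: power2_eq_square) (simp add: field_simps)
    finally show ?thesis .
  qed
  have p1: "w * a1 (1 / w) / w\<^sup>2 = g w" "(1 / w) * a1 (1 / w) = g w" if "w \<notin> S" for w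
    using b1[OF that] nz(1)[OF that] by (simp_all add: power2_eq_square)
  have p2: "w\<^sup>2 * (a2 (1 / w) / w ^ 4) = h w" "(1 / w)\<^sup>2 * a2 (1 / w) = h w" if "w \<notin> S" for w
    using b2[OF that] nz(1)[OF that] by (simp_all add: power2_eq_square power4_eq_xxxx)
  have l1: "((\<lambda>s. s * a1 s) \<longlongrightarrow> 3) at_infinity"
    using tendsto_at_eq_analytic[OF g p1(2) S]
    by (simp add: lim_at_infinity_0 o_def g_def inverse_eq_divide)
  have l2: "((\<lambda>s. s\<^sup>2 * a2 s) \<longlongrightarrow> 3/4) at_infinity"
    using tendsto_at_eq_analytic[OF h p2(2) S]
    by (simp add: lim_at_infinity_0 o_def h_def inverse_eq_divide)
  have "indicial_poly_infinity 3 (3/4) = [:- (1/2), 1:] * [:- (3/2), 1:]"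
    by (simp add: indicial_poly_infinity_def one_pCons)
  then have "has_indices_at_infinity a1 a2 {#1/2, 3/2#}"
    unfolding has_indices_at_infinity_def using l1 l2 proots_quadratic by metis
  moreover have "regular_singular_at_infinity a1 a2"
  proof -
    have k: "(\<lambda>w. 2 - g w) analytic_on {0}"
      by (intro analytic_intros g)
    have p3: "(w - 0) * (2 / w - a1 (1 / w) / w\<^sup>2) = 2 - g w" if "w \<notin> S" for w
      using p1(1)[OF that] nz(1)[OF that] by (simp add: algebra_simps)
    have p4: "(w - 0)\<^sup>2 * (a2 (1 / w) / w ^ 4) = h w" if "w \<notin> S" for w
      using p2(1)[OF that] by simp
    \<comment> \<open>The limit is \<open>2 - g 0\<close> with \<open>g 0 = 3\<close>; being
      nonzero, it rules out an ordinary point at infinity.\<close>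
    have "((\<lambda>w. (w - 0) * (2 / w - a1 (1 / w) / w\<^sup>2)) \<longlongrightarrow> - 1) (at 0)"
      using tendsto_at_eq_analytic[OF k p3 S] by (simp add: g_def)
    from not_extends_analytically_at_simple_pole[OF this]
    show ?thesis
      unfolding regular_singular_at_infinity_def regular_singular_point_def ordinary_point_def
      using extends_analytically_atI[OF k p3 S] extends_analytically_atI[OF h p4 S] by simp
  qed
  ultimately show ?thesis by blast
qed

end

section \<open>Application to the given equation\<close>

lemma lame_coeffs_normal:
  assumes "e1 > e2" "e2 > e3"
  shows "lame_coeffs (of_real e1) (of_real e2) (of_real e3) (of_real ((e1 + e2 + e3) / 4))
    (normal_coeff1 e1 e2 e3) (normal_coeff2 e1 e2 e3)"
proof
  fix s :: complex assume s: "s \<notin> {of_real e1, of_real e2, of_real e3}"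
  \<comment> \<open>The quotient \<open>Q' / Q\<close> is a logarithmic derivative, hence the sum of
    the reciprocals of the three factors.\<close>
  have sum: "8 * (b * c + a * c + a * b) / (8 * (a * b * c)) = 1 / a + 1 / b + 1 / c"
    if "a \<noteq> 0" "b \<noteq> 0" "c \<noteq> 0" for a b c :: complex
    using that by (simp add: add_divide_distrib)
  show "normal_coeff1 e1 e2 e3 s = 1 / (s - of_real e1) + 1 / (s - of_real e2) + 1 / (s - of_real e3)"
    unfolding normal_coeff1_def coeff1_def coeff0_def lame_cubic_derivs lame_cubic_def
    using s by (intro sum) auto
  \<comment> \<open>Division by the leading 8 yields both the coefficient 3/4 and the accessory
    parameter.\<close>
  have "6 * s - 2 * (of_real e1 + of_real e2 + of_real e3) =
      8 * (3/4 * s - of_real ((e1 + e2 + e3) / 4))"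
    by (simp add: field_simps)
  then show "normal_coeff2 e1 e2 e3 s = (3/4 * s - of_real ((e1 + e2 + e3) / 4)) /
      ((s - of_real e1) * (s - of_real e2) * (s - of_real e3))"
    unfolding normal_coeff2_def coeff2_def coeff0_def lame_cubic_derivs lame_cubic_def
    by (metis mult_divide_mult_cancel_left zero_neq_numeral)
qed

theorem theorem2:
  fixes e1 e2 e3 :: real
  assumes "e1 > e2" and "e2 > e3"
  shows "solves_linear_ode2_on (coeff0 e1 e2 e3) (coeff1 e1 e2 e3) (coeff2 e1 e2 e3)
           (rho_Q e1 e2 e3) {e3<..<e2} \<and>
    solves_linear_ode2_on (coeff0 e1 e2 e3) (coeff1 e1 e2 e3) (coeff2 e1 e2 e3)
           (rho_Q e1 e2 e3) {e2<..<e1} \<and>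
    heun_equation (of_real e1) (of_real e2) (of_real e3)
           (normal_coeff1 e1 e2 e3) (normal_coeff2 e1 e2 e3) \<and>
    {z. regular_singular_point (normal_coeff1 e1 e2 e3) (normal_coeff2 e1 e2 e3) z} =
           {of_real e1, of_real e2, of_real e3} \<and>
    regular_singular_at_infinity (normal_coeff1 e1 e2 e3) (normal_coeff2 e1 e2 e3) \<and>
    (\<forall>z \<in> {of_real e1, of_real e2, of_real e3}.
           has_indices_at (normal_coeff1 e1 e2 e3) (normal_coeff2 e1 e2 e3) {#0, 0#} z) \<and>
    has_indices_at_infinity (normal_coeff1 e1 e2 e3) (normal_coeff2 e1 e2 e3)
           {#1/2, 3/2#}"
proof -
  interpret lame_coeffs "of_real e1" "of_real e2" "of_real e3" "of_real ((e1 + e2 + e3) / 4)"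
    "normal_coeff1 e1 e2 e3" "normal_coeff2 e1 e2 e3"
    using assms by (rule lame_coeffs_normal)
  \<comment> \<open>Permuting the singular points moves \<open>e2\<close> and \<open>e3\<close> to
    the first place, where \<open>finite_singularity\<close> applies.\<close>
  have c2: "lame_coeffs (of_real e2) (of_real e1) (of_real e3) (of_real ((e1 + e2 + e3) / 4))
      (normal_coeff1 e1 e2 e3) (normal_coeff2 e1 e2 e3)"
    and c3: "lame_coeffs (of_real e3) (of_real e1) (of_real e2) (of_real ((e1 + e2 + e3) / 4))
      (normal_coeff1 e1 e2 e3) (normal_coeff2 e1 e2 e3)"
    by (unfold_locales, simp_all add: a1 a2 mult_ac add_ac)+
  have sing: "regular_singular_point (normal_coeff1 e1 e2 e3) (normal_coeff2 e1 e2 e3) z \<and>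
      has_indices_at (normal_coeff1 e1 e2 e3) (normal_coeff2 e1 e2 e3) {#0, 0#} z"
    if "z \<in> {of_real e1, of_real e2, of_real e3}" for z
    using that assms finite_singularity lame_coeffs.finite_singularity[OF c2]
      lame_coeffs.finite_singularity[OF c3] by auto
  \<comment> \<open>All three \<open>gamma\<close> are 1, and \<open>alpha\<close>,
    \<open>beta\<close> are 1/2, 3/2: the product is 3/4, and the Fuchs relation reads 3 = 1/2 + 3/2
    + 1.\<close>
  have heun: "heun_equation (of_real e1) (of_real e2) (of_real e3)
      (normal_coeff1 e1 e2 e3) (normal_coeff2 e1 e2 e3)"
    unfolding heun_equation_def
    by (intro conjI exI[of _ 1] exI[of _ "1/2"] exI[of _ "3/2"]
        exI[of _ "of_real ((e1 + e2 + e3) / 4)"]) (use assms in \<open>auto simp: a1 a2\<close>)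
  have "{z. regular_singular_point (normal_coeff1 e1 e2 e3) (normal_coeff2 e1 e2 e3) z} =
      {of_real e1, of_real e2, of_real e3}"
    using sing ordinary unfolding regular_singular_point_def by blast
  then show ?thesis
    using rho_Q_solves_left[OF assms] rho_Q_solves_right[OF assms] heun sing infinity by blast
qed

end
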